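(* Let $\mathcal{P}$ be any graph property that is preserved by the $\nabla\mathrm{Y}$ move and by contracting an edge incident to a vertex of degree two. Then in every graph that is minor minimal with respect to $\mathcal{P}$, every vertex of degree 3 has a claw neighborhood; that is, if $G$ is minor minimal with respect to $\mathcal{P}$ and $x$ is a vertex of degree 3 in $G$ with neighbors $a,b,c$, then the subgraph of $G$ induced by $\{x,a,b,c\}$ is a $K_{3,1}$ with edges exactly $xa, xb, xc$.
   Context: Graphs are finite and simple; a graph property is invariant under isomorphism. A minor of $G$ is a graph obtained from $G$ by a sequence of edge deletions, vertex deletions and edge contractions; it is proper if at least one such operation is used. A graph $G$ is minor minimal with respect to $\mathcal{P}$ if $G$ has property $\mathcal{P}$ but no proper minor of $G$ has property $\mathcal{P}$. A $\nabla\mathrm{Y}$ move on a triangle with vertices $u,v,w$ deletes the three edges $uv, vw, uw$ and adds a new vertex $y$ together with the edges $yu, yv, yw$. *)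

theory Defs
  imports "Graph_Theory.Graph_Theory"
begin

text \<open>
  Finite simple graphs are the loop-free symmetric finite digraphs of the locale
  \<^locale>\<open>pair_graph\<close>: the edge \<open>uv\<close> is the pair of arcs \<open>(u, v)\<close>, \<open>(v, u)\<close>. The degree of a
  vertex is therefore its \<^const>\<open>out_degree\<close>, each incident edge contributing one outgoing arc.
\<close>

definition iso_invariant :: "('a pair_pre_digraph \<Rightarrow> bool) \<Rightarrow> bool" where
  "iso_invariant P \<longleftrightarrow>
     (\<forall>G H. pair_graph G \<longrightarrow> pair_graph H \<longrightarrow> digraph_iso (with_proj G) (with_proj H) \<longrightarrow>
        (P G \<longleftrightarrow> P H))"

definition delete_edge :: "'a pair_pre_digraph \<Rightarrow> 'a \<Rightarrow> 'a \<Rightarrow> 'a pair_pre_digraph" where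
  "delete_edge G u v = \<lparr>pverts = pverts G, parcs = parcs G - {(u, v), (v, u)}\<rparr>"

definition delete_vertex :: "'a pair_pre_digraph \<Rightarrow> 'a \<Rightarrow> 'a pair_pre_digraph" where
  "delete_vertex G v =
     \<lparr>pverts = pverts G - {v}, parcs = {e \<in> parcs G. fst e \<noteq> v \<and> snd e \<noteq> v}\<rparr>"

text \<open>
  Contraction of \<open>uv\<close> as an operation on simple graphs: \<open>v\<close> is identified with \<open>u\<close> (the merged
  vertex keeps the name \<open>u\<close>), the resulting loop is dropped and parallel edges coincide.
\<close>

definition contract_edge :: "'a pair_pre_digraph \<Rightarrow> 'a \<Rightarrow> 'a \<Rightarrow> 'a pair_pre_digraph" where
  "contract_edge G u v =
     (let f = (\<lambda>w. if w = v then u else w)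
      in \<lparr>pverts = f ` pverts G,
          parcs = {(f s, f t) | s t. (s, t) \<in> parcs G \<and> f s \<noteq> f t}\<rparr>)"

inductive minor_step :: "'a pair_pre_digraph \<Rightarrow> 'a pair_pre_digraph \<Rightarrow> bool" where
  edge_deletion: "(u, v) \<in> parcs G \<Longrightarrow> minor_step G (delete_edge G u v)"
| vertex_deletion: "v \<in> pverts G \<Longrightarrow> minor_step G (delete_vertex G v)"
| edge_contraction: "(u, v) \<in> parcs G \<Longrightarrow> minor_step G (contract_edge G u v)"

definition proper_minor :: "'a pair_pre_digraph \<Rightarrow> 'a pair_pre_digraph \<Rightarrow> bool" where
  "proper_minor H G \<longleftrightarrow> minor_step\<^sup>+\<^sup>+ G H"

definition minor_minimal ::
    "('a pair_pre_digraph \<Rightarrow> bool) \<Rightarrow> 'a pair_pre_digraph \<Rightarrow> bool" where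
  "minor_minimal P G \<longleftrightarrow> pair_graph G \<and> P G \<and> (\<forall>H. proper_minor H G \<longrightarrow> \<not> P H)"

definition triangle :: "'a pair_pre_digraph \<Rightarrow> 'a \<Rightarrow> 'a \<Rightarrow> 'a \<Rightarrow> bool" where
  "triangle G u v w \<longleftrightarrow> (u, v) \<in> parcs G \<and> (v, w) \<in> parcs G \<and> (u, w) \<in> parcs G"

definition nabla_Y ::
    "'a pair_pre_digraph \<Rightarrow> 'a \<Rightarrow> 'a \<Rightarrow> 'a \<Rightarrow> 'a \<Rightarrow> 'a pair_pre_digraph" where
  "nabla_Y G u v w y =
     \<lparr>pverts = insert y (pverts G),
      parcs = (parcs G - {(u, v), (v, u), (v, w), (w, v), (u, w), (w, u)})
                \<union> {(y, u), (u, y), (y, v), (v, y), (y, w), (w, y)}\<rparr>"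

definition preserved_by_nabla_Y :: "('a pair_pre_digraph \<Rightarrow> bool) \<Rightarrow> bool" where
  "preserved_by_nabla_Y P \<longleftrightarrow>
     (\<forall>G u v w y. pair_graph G \<longrightarrow> P G \<longrightarrow> triangle G u v w \<longrightarrow> y \<notin> pverts G \<longrightarrow>
        P (nabla_Y G u v w y))"

definition preserved_by_degree_two_contraction :: "('a pair_pre_digraph \<Rightarrow> bool) \<Rightarrow> bool" where
  "preserved_by_degree_two_contraction P \<longleftrightarrow>
     (\<forall>G u v. pair_graph G \<longrightarrow> P G \<longrightarrow> (u, v) \<in> parcs G \<longrightarrow>
        out_degree (with_proj G) u = 2 \<or> out_degree (with_proj G) v = 2 \<longrightarrow>
        P (contract_edge G u v))"

lemma pair_graph_iff:
  "pair_graph G \<longleftrightarrow>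
     finite (pverts G) \<and> parcs G \<subseteq> pverts G \<times> pverts G \<and> sym (parcs G) \<and> irrefl (parcs G)"
proof
  assume "pair_graph G"
  then interpret pair_graph G .
  have "sym (parcs G)" using arcs_symmetric by (rule symI)
  moreover have "irrefl (parcs G)" using no_loops' by (intro irreflI) blast
  moreover have "parcs G \<subseteq> pverts G \<times> pverts G" 
    using in_arcsD1 in_arcsD2 by (intro subrelI) simp
  ultimately show "finite (pverts G) \<and> parcs G \<subseteq> pverts G \<times> pverts G \<and> sym (parcs G) \<and> irrefl (parcs G)"
    using pair_finite_verts by simp
next
  assume A: "finite (pverts G) \<and> parcs G \<subseteq> pverts G \<times> pverts G \<and> sym (parcs G) \<and> irrefl (parcs G)"
  then have "finite (parcs G)"
    by (intro finite_subset[of "parcs G" "pverts G \<times> pverts G"]) simp_all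
  moreover have "e \<in> parcs G \<Longrightarrow> fst e \<in> pverts G \<and> snd e \<in> pverts G" for e
    using A mem_Times_iff[of e "pverts G" "pverts G"] by auto
  moreover have "e \<in> parcs G \<Longrightarrow> fst e \<noteq> snd e" for e
    using A irreflD[of "parcs G" "fst e"] by (metis prod.collapse)
  ultimately show "pair_graph G"
    using A by unfold_locales (simp_all add: symmetric_def)
qed

lemma pair_graph_delete_edge: "pair_graph G \<Longrightarrow> pair_graph (delete_edge G u v)"
  by (auto simp: pair_graph_iff delete_edge_def intro!: symI irreflI dest: symD irreflD)

lemma pair_graph_delete_vertex: "pair_graph G \<Longrightarrow> pair_graph (delete_vertex G v)"
  by (auto simp: pair_graph_iff delete_vertex_def intro!: symI irreflI dest: symD irreflD)

lemma with_proj_delete_vertex: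
  "with_proj (delete_vertex G v) = pre_digraph.del_vert (with_proj G) v"
  by (simp add: with_proj_def delete_vertex_def pre_digraph.del_vert_def)

lemma pair_graph_contract_edge:
  assumes "pair_graph G" shows "pair_graph (contract_edge G u v)"
proof -
  define f where "f = (\<lambda>w. if w = v then u else w)"
  have C: "contract_edge G u v =
      \<lparr>pverts = f ` pverts G, parcs = {(f s, f t) | s t. (s, t) \<in> parcs G \<and> f s \<noteq> f t}\<rparr>"
    by (simp add: contract_edge_def f_def)
  have G: "finite (pverts G)" "parcs G \<subseteq> pverts G \<times> pverts G" "sym (parcs G)"
    using assms by (simp_all add: pair_graph_iff)
  have "sym {(f s, f t) | s t. (s, t) \<in> parcs G \<and> f s \<noteq> f t}"
  proof (rule symI)
    fix p q assume "(p, q) \<in> {(f s, f t) | s t. (s, t) \<in> parcs G \<and> f s \<noteq> f t}"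
    then obtain s t where "(s, t) \<in> parcs G" "f s \<noteq> f t" "p = f s" "q = f t" by blast
    moreover from this have "(t, s) \<in> parcs G" using G(3) by (blast dest: symD)
    ultimately show "(q, p) \<in> {(f s, f t) | s t. (s, t) \<in> parcs G \<and> f s \<noteq> f t}"
      by (metis (mono_tags, lifting) mem_Collect_eq)
  qed
  moreover have "irrefl {(f s, f t) | s t. (s, t) \<in> parcs G \<and> f s \<noteq> f t}"
    by (auto simp: irrefl_def)
  moreover have "{(f s, f t) | s t. (s, t) \<in> parcs G \<and> f s \<noteq> f t} \<subseteq> f ` pverts G \<times> f ` pverts G"
    using G(2) by auto
  ultimately show ?thesis
    unfolding C using G(1) by (simp add: pair_graph_iff)
qed

lemma pair_graph_nabla_Y:
  assumes "pair_graph G" "triangle G u v w" "y \<notin> pverts G"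
  shows "pair_graph (nabla_Y G u v w y)"
proof -
  have G: "finite (pverts G)" "parcs G \<subseteq> pverts G \<times> pverts G" "sym (parcs G)" "irrefl (parcs G)"
    using assms(1) by (simp_all add: pair_graph_iff)
  have V: "{u, v, w} \<subseteq> pverts G" and Y: "y \<notin> {u, v, w}"
    using G(2) assms(2,3) by (auto simp: triangle_def)
  define S where "S = {(u, v), (v, u), (v, w), (w, v), (u, w), (w, u)}"
  define T where "T = {(y, u), (u, y), (y, v), (v, y), (y, w), (w, y)}"
  have S: "sym S" and T1: "sym T"
    by (auto simp: S_def T_def intro!: symI)
  have T2: "irrefl T"
    using Y by (auto simp: T_def irrefl_def)
  have T3: "T \<subseteq> insert y (pverts G) \<times> insert y (pverts G)"
    using V by (simp add: T_def)
  have "sym (parcs G - S \<union> T)"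
    using G(3) S T1 unfolding sym_def by blast
  moreover have "irrefl (parcs G - S \<union> T)"
    using G(4) T2 unfolding irrefl_def by blast
  moreover have "parcs G - S \<union> T \<subseteq> insert y (pverts G) \<times> insert y (pverts G)"
    using G(2) T3 by blast
  ultimately show ?thesis
    using G(1) by (simp add: pair_graph_iff nabla_Y_def flip: S_def T_def)
qed

lemma pair_graph_minor_step: "minor_step G H \<Longrightarrow> pair_graph G \<Longrightarrow> pair_graph H"
  by (induction rule: minor_step.induct)
     (simp_all add: pair_graph_delete_edge pair_graph_delete_vertex pair_graph_contract_edge)

lemma pair_graph_proper_minor: "proper_minor H G \<Longrightarrow> pair_graph G \<Longrightarrow> pair_graph H"
  unfolding proper_minor_def
  by (induction rule: tranclp_induct) (auto intro: pair_graph_minor_step)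

end

theory Submission
  imports Defs
begin

text \<open>
  If two neighbours \<open>a\<close>, \<open>b\<close> of the degree-3 vertex \<open>x\<close> were adjacent, a \<open>\<nabla>Y\<close> move on the triangle
  \<open>xab\<close> would leave \<open>x\<close> with degree two, adjacent only to its third neighbour and to the new
  vertex \<open>y\<close>. Contracting \<open>xy\<close> gives back \<open>G\<close> without the edge \<open>ab\<close>, a proper minor of \<open>G\<close> that
  has the property. Since the merged vertex keeps the name \<open>x\<close>, this is an equality of graphs and not
  merely an isomorphism.
\<close>

text \<open>Arcs are pairs, so an arc leaving \<open>v\<close> is determined by its head.\<close>

lemma out_degree_with_proj: "out_degree (with_proj G) v = card {w. (v, w) \<in> parcs G}"
proof -
  have "out_arcs (with_proj G) v = Pair v ` {w. (v, w) \<in> parcs G}"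
    by (auto simp: out_arcs_def)
  then show ?thesis
    by (simp add: out_degree_def card_image inj_on_def)
qed

text \<open>The move takes the neighbours \<open>v\<close> and \<open>w\<close> from
  \<open>u\<close> and gives it \<open>y\<close> instead, a net loss of one.\<close>

lemma out_degree_nabla_Y:
  assumes "pair_graph G" "triangle G u v w" "y \<notin> pverts G"
  shows "out_degree (with_proj (nabla_Y G u v w y)) u + 1 = out_degree (with_proj G) u"
proof -
  let ?N = "{t. (u, t) \<in> parcs G}"
  have G: "finite (pverts G)" "parcs G \<subseteq> pverts G \<times> pverts G" "irrefl (parcs G)"
    using assms(1) by (simp_all add: pair_graph_iff)
  have vw: "v \<in> ?N" "w \<in> ?N" "v \<noteq> w" and y: "y \<notin> ?N" "y \<noteq> u" and uvw: "u \<noteq> v" "u \<noteq> w"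
    using G(2,3) assms(2,3) by (auto simp: triangle_def irrefl_def)
  have fin: "finite ?N"
    using G(1,2) by (auto intro: finite_subset[of _ "pverts G"])
  have "{t. (u, t) \<in> parcs (nabla_Y G u v w y)} = insert y (?N - {v, w})"
    using y uvw by (auto simp: nabla_Y_def)
  moreover have "card (?N - {v, w}) = card ?N - 2"
    using vw by (simp add: card_Diff_subset)
  \<comment> \<open>This keeps the natural-number difference \<open>card ?N - 2\<close> from being
    truncated.\<close>
  moreover have "2 \<le> card ?N"
    using card_mono[of ?N "{v, w}"] fin vw by simp
  ultimately show ?thesis
    using fin y by (simp add: out_degree_with_proj)
qed

text \<open>Merging \<open>y\<close> into \<open>u\<close> turns \<open>yv\<close> and
  \<open>yw\<close> back into the triangle edges \<open>uv\<close> and \<open>uw\<close>, while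
  \<open>yu\<close> becomes a loop and is dropped. Only \<open>vw\<close> is not restored.\<close>

lemma contract_edge_nabla_Y:
  assumes "pair_graph G" "triangle G u v w" "y \<notin> pverts G"
  shows "contract_edge (nabla_Y G u v w y) u y = delete_edge G v w"
proof -
  define f where "f = (\<lambda>t. if t = y then u else t)"
  have G: "parcs G \<subseteq> pverts G \<times> pverts G" "sym (parcs G)" "irrefl (parcs G)"
    using assms(1) by (simp_all add: pair_graph_iff)
  have arcs: "(u, v) \<in> parcs G" "(v, u) \<in> parcs G" "(u, w) \<in> parcs G" "(w, u) \<in> parcs G"
    using G(2) assms(2) by (auto simp: triangle_def dest: symD)
  have uvw: "u \<noteq> v" "u \<noteq> w" "v \<noteq> w" and y: "y \<noteq> u" "y \<noteq> v" "y \<noteq> w" and u: "u \<in> pverts G"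
    using G(1,3) assms(2,3) by (auto simp: triangle_def irrefl_def)
  have old: "s \<noteq> y" "t \<noteq> y" "s \<noteq> t" if "(s, t) \<in> parcs G" for s t
    using that G(1,3) assms(3) by (auto simp: irrefl_def)
  let ?A = "parcs (nabla_Y G u v w y)"
  have "f ` pverts (nabla_Y G u v w y) = pverts G"
    using u assms(3) by (auto simp: f_def nabla_Y_def)
  moreover have "{(f s, f t) | s t. (s, t) \<in> ?A \<and> f s \<noteq> f t} = parcs G - {(v, w), (w, v)}"
  proof (rule set_eqI, clarify, rule iffI)
    fix p q assume "(p, q) \<in> {(f s, f t) | s t. (s, t) \<in> ?A \<and> f s \<noteq> f t}"
    then obtain s t where "(s, t) \<in> ?A" "f s \<noteq> f t" "p = f s" "q = f t" by blast
    then show "(p, q) \<in> parcs G - {(v, w), (w, v)}"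
      using arcs uvw y old by (auto simp: nabla_Y_def f_def split: if_splits)
  next
    fix p q assume pq: "(p, q) \<in> parcs G - {(v, w), (w, v)}"
    \<comment> \<open>Preimage of the arc \<open>(p, q)\<close>: arcs joining \<open>u\<close> to
      \<open>v\<close> or \<open>w\<close> were removed by the move and come from arcs at
      \<open>y\<close>; every other arc survived the move and is its own preimage.\<close>
    define s where "s = (if p = u \<and> q \<in> {v, w} then y else p)"
    define t where "t = (if q = u \<and> p \<in> {v, w} then y else q)"
    have "(s, t) \<in> ?A" "f s = p" "f t = q" "p \<noteq> q"
      using pq uvw y old by (auto simp: nabla_Y_def f_def s_def t_def)
    then show "(p, q) \<in> {(f s, f t) | s t. (s, t) \<in> ?A \<and> f s \<noteq> f t}" by blast
  qed
  ultimately show ?thesis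
    by (simp add: contract_edge_def delete_edge_def flip: f_def)
qed

lemma minor_minimal_degree_3_no_triangle:
  fixes P :: "'a pair_pre_digraph \<Rightarrow> bool"
  assumes "infinite (UNIV :: 'a set)"
    and "preserved_by_nabla_Y P" "preserved_by_degree_two_contraction P"
    and "minor_minimal P G" "out_degree (with_proj G) x = 3"
  shows "\<not> triangle G x u v"
proof
  assume tri: "triangle G x u v"
  have G: "pair_graph G" "P G" and minimal: "\<And>H. proper_minor H G \<Longrightarrow> \<not> P H"
    using assms(4) by (simp_all add: minor_minimal_def)
  \<comment> \<open>The vertex set is finite and the vertex type infinite, so a fresh vertex
    exists.\<close>
  obtain y where y: "y \<notin> pverts G"
    using ex_new_if_finite[OF assms(1)] G(1) by (auto simp: pair_graph_iff)
  let ?H = "nabla_Y G x u v y"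
  have "P ?H"
    using assms(2) G tri y by (simp add: preserved_by_nabla_Y_def)
  moreover have "pair_graph ?H"
    using G(1) tri y by (rule pair_graph_nabla_Y)
  moreover have "(x, y) \<in> parcs ?H"
    by (simp add: nabla_Y_def)
  moreover have "out_degree (with_proj ?H) x = 2"
    using out_degree_nabla_Y[OF G(1) tri y] assms(5) by simp
  ultimately have "P (contract_edge ?H x y)"
    using assms(3) by (simp add: preserved_by_degree_two_contraction_def)
  then have "P (delete_edge G u v)"
    by (simp add: contract_edge_nabla_Y[OF G(1) tri y])
  moreover have "proper_minor (delete_edge G u v) G"
    using tri by (auto simp: proper_minor_def triangle_def intro: edge_deletion)
  ultimately show False
    using minimal by blast
qed

text \<open>Puts the induced subgraph into the form \<open>with_proj\<close>, to which
  \<open>complete_bipartite_digraph_pair_def\<close> applies.\<close>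

lemma with_proj_induce_subgraph:
  "with_proj G \<restriction> S = with_proj \<lparr>pverts = S, parcs = parcs G \<inter> S \<times> S\<rparr>"
  by (auto simp: with_proj_def induce_subgraph_def)

theorem lemma7:
  fixes P :: "'a pair_pre_digraph \<Rightarrow> bool"
    and G :: "'a pair_pre_digraph"
    and x a b c :: 'a
  assumes "infinite (UNIV :: 'a set)"
    and "iso_invariant P"
    and "preserved_by_nabla_Y P"
    and "preserved_by_degree_two_contraction P"
    and "minor_minimal P G"
    and "x \<in> pverts G"
    and "out_degree (with_proj G) x = 3"
    and "{v. (x, v) \<in> parcs G} = {a, b, c}"
  shows "complete_bipartite_digraph 3 1 (with_proj G \<restriction> {x, a, b, c})
       \<and> arcs_ends (with_proj G \<restriction> {x, a, b, c}) = {(x, a), (a, x), (x, b), (b, x), (x, c), (c, x)}"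
proof -
  define N where "N = {a, b, c}"
  have G: "sym (parcs G)" "irrefl (parcs G)"
    using assms(5) by (simp_all add: minor_minimal_def pair_graph_iff)
  have N: "{v. (x, v) \<in> parcs G} = N"
    using assms(8) by (simp only: N_def)
  have nbr: "(x, v) \<in> parcs G \<longleftrightarrow> v \<in> N" "(v, x) \<in> parcs G \<longleftrightarrow> v \<in> N" for v
    using N G(1) by (auto dest: symD)
  have x: "x \<notin> N"
    using nbr(1)[of x] G(2) by (simp add: irrefl_def)
  \<comment> \<open>An arc between two neighbours of \<open>x\<close> would complete a triangle
    through \<open>x\<close>.\<close>
  have indep: "(u, v) \<notin> parcs G" if "u \<in> N" "v \<in> N" for u v
    using minor_minimal_degree_3_no_triangle[OF assms(1,3-5,7), of u v] that
    by (simp add: triangle_def nbr)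
  have arcs: "parcs G \<inter> insert x N \<times> insert x N = N \<times> {x} \<union> {x} \<times> N"
  proof -
    have "(u, v) \<in> parcs G \<inter> insert x N \<times> insert x N \<longleftrightarrow>
        (u, v) \<in> N \<times> {x} \<union> {x} \<times> N" for u v
      \<comment> \<open>Pairs inside \<open>N\<close> are excluded by \<open>indep\<close>, the pair
        \<open>(x, x)\<close> by \<open>x \<notin> N\<close>; the mixed pairs are all arcs.\<close>
      using indep[of u v] x by (cases "u = x"; cases "v = x") (auto simp: nbr)
    then show ?thesis by (simp only: set_eq_iff split_paired_All simp_thms)
  qed
  have fin: "finite N"
    by (simp add: N_def)
  \<comment> \<open>Since \<open>x\<close> has degree 3, the vertices \<open>a\<close>,
    \<open>b\<close>, \<open>c\<close> are pairwise distinct.\<close>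
  have "card N = 3"
    using assms(7) by (simp add: out_degree_with_proj N)
  then have "complete_bipartite_digraph 3 1 (with_proj G \<restriction> insert x N)"
    unfolding with_proj_induce_subgraph arcs complete_bipartite_digraph_pair_def
    \<comment> \<open>The two sides of the bipartition are \<open>N\<close>, of size 3, and
      \<open>{x}\<close>, of size 1.\<close>
    using x by (intro conjI exI[of _ N] exI[of _ "{x}"]) (simp_all add: fin)
  moreover have "arcs_ends (with_proj G \<restriction> insert x N) = N \<times> {x} \<union> {x} \<times> N"
    unfolding with_proj_induce_subgraph arcs by simp
  moreover have "N \<times> {x} \<union> {x} \<times> N = {(x, a), (a, x), (x, b), (b, x), (x, c), (c, x)}"
    by (auto simp: N_def)
  ultimately show ?thesis
    by (simp only: N_def)
qed

end
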